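(* Let an instance of the network design setting ($\mathcal{N}=(N,E)$, costs $b,c$, arc lengths $d$, O/D pairs $W$, demands $g$, private utilities $u$, and $\alpha\in[0,1]$) be given. For each $\lambda\in(0,1)$, every maximum $\lambda$-cent-dian belongs to $\mathcal{PO}^\alpha_2$.
   Context: Setting. $\mathcal{N}=(N,E)$ is a finite undirected graph with node costs $b_i\ge 0$ ($i\in N$) and edge costs $c_e\ge 0$ ($e\in E$). Each edge $\{i,j\}\in E$ gives two arcs $(i,j)$ and $(j,i)$; each arc $a$ has a length $d_a\ge 0$. $W\subset N\times N$ is a finite nonempty set of origin/destination pairs $w=(w^s,w^t)$ with $w^s\ne w^t$; each $w\in W$ has a demand $g^w>0$ and a private utility $u^w>0$. Put $G=\sum_{w\in W}g^w$. Feasible subgraphs. For $\alpha\in[0,1]$, $\mathcal{N}^\alpha$ is the set of all subgraphs $\mathcal{S}=(N_{\mathcal S},E_{\mathcal S})$ of $\mathcal N$ (the empty subgraph is allowed) with $\sum_{i\in N_{\mathcal S}}b_i+\sum_{e\in E_{\mathcal S}}c_e\le \alpha\big(\sum_{i\in N}b_i+\sum_{e\in E}c_e\big)$. Lengths. For a subgraph $\mathcal S$ and $w\in W$, $d_{\mathcal S}(w)$ is the length of a shortest path from $w^s$ to $w^t$ using arcs arising from edges of $\mathcal S$, with $d_{\mathcal S}(w)=+\infty$ if no such path exists in $\mathcal{S}$; and $\ell_{\mathcal S}(w)=\min\{d_{\mathcal S}(w),u^w\}$. Objectives. $F_m(\mathcal S)=\frac1G\sum_{w\in W}g^w\ell_{\mathcal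 S}(w)$, $F_c(\mathcal S)=\max_{w\in W}\ell_{\mathcal S}(w)$, $H_\lambda(\mathcal S)=\lambda F_c(\mathcal S)+(1-\lambda)F_m(\mathcal S)$, and $\bar H_\lambda(\mathcal S)=\max\{\lambda F_c(\mathcal S),(1-\lambda)F_m(\mathcal S)\}$. Maximum $\lambda$-cent-dian. A subgraph $\mathcal S\in\mathcal N^\alpha$ is a maximum $\lambda$-cent-dian if it is an optimal solution of $\operatorname{lex}\min\{[\bar H_\lambda(\mathcal S),H_\lambda(\mathcal S)]:\mathcal S\in\mathcal N^\alpha\}$, i.e. it minimizes $H_\lambda$ among all minimizers of $\bar H_\lambda$ over $\mathcal N^\alpha$. Pareto-optimality. $\mathcal{PO}^\alpha_2$ is the set of all $\mathcal S\in\mathcal N^\alpha$ for which there is no $\mathcal S'\in\mathcal N^\alpha$ with $F_m(\mathcal S')\le F_m(\mathcal S)$ and $F_c(\mathcal S')\le F_c(\mathcal S)$, at least one of the two inequalities being strict. *)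

theory Defs
  imports Complex_Main "HOL-Library.Extended_Real" "Graph_Theory.Graph_Theory"
begin

record 'v ugraph =
  nodes :: "'v set"
  edges :: "'v set set"

definition wf_ugraph :: "'v ugraph \<Rightarrow> bool" where
  "wf_ugraph S \<longleftrightarrow>
     finite (nodes S) \<and> (\<forall>e \<in> edges S. \<exists>i j. e = {i, j} \<and> i \<noteq> j \<and> i \<in> nodes S \<and> j \<in> nodes S)"

definition usubgraph :: "'v ugraph \<Rightarrow> 'v ugraph \<Rightarrow> bool" where
  "usubgraph S T \<longleftrightarrow> nodes S \<subseteq> nodes T \<and> edges S \<subseteq> edges T \<and> wf_ugraph S"

definition bidirected :: "'v ugraph \<Rightarrow> 'v pair_pre_digraph" where
  "bidirected S = \<lparr> pverts = nodes S, parcs = {(i, j). {i, j} \<in> edges S} \<rparr>"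

text \<open>An O/D pair is \<open>w = (fst w, snd w)\<close>, origin first. Arcs are pairs as well.\<close>

record 'v nd_instance =
  network :: "'v ugraph"
  node_cost :: "'v \<Rightarrow> real"
  edge_cost :: "'v set \<Rightarrow> real"
  arc_length :: "'v \<times> 'v \<Rightarrow> real"
  od_pairs :: "('v \<times> 'v) set"
  demand :: "'v \<times> 'v \<Rightarrow> real"
  utility :: "'v \<times> 'v \<Rightarrow> real"

locale network_design =
  fixes I :: "'v nd_instance"
  assumes wf_network: "wf_ugraph (network I)"
    and node_cost_nonneg: "\<And>i. i \<in> nodes (network I) \<Longrightarrow> node_cost I i \<ge> 0"
    and edge_cost_nonneg: "\<And>e. e \<in> edges (network I) \<Longrightarrow> edge_cost I e \<ge> 0"
    and arc_length_nonneg: "\<And>a. a \<in> parcs (bidirected (network I)) \<Longrightarrow> arc_length I a \<ge> 0"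
    and od_finite: "finite (od_pairs I)"
    and od_nonempty: "od_pairs I \<noteq> {}"
    and od_nodes: "od_pairs I \<subseteq> nodes (network I) \<times> nodes (network I)"
    and od_distinct: "\<And>w. w \<in> od_pairs I \<Longrightarrow> fst w \<noteq> snd w"
    and demand_pos: "\<And>w. w \<in> od_pairs I \<Longrightarrow> demand I w > 0"
    and utility_pos: "\<And>w. w \<in> od_pairs I \<Longrightarrow> utility I w > 0"

definition total_cost :: "'v nd_instance \<Rightarrow> 'v ugraph \<Rightarrow> real" where
  "total_cost I S = (\<Sum>i\<in>nodes S. node_cost I i) + (\<Sum>e\<in>edges S. edge_cost I e)"

definition feasible :: "'v nd_instance \<Rightarrow> real \<Rightarrow> 'v ugraph set" where
  "feasible I \<alpha> =
     {S. usubgraph S (network I) \<and> total_cost I S \<le> \<alpha> * total_cost I (network I)}"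

text \<open>
  The library constant \<open>\<mu>\<close> is the infimum in the extended reals of the costs of all directed
  walks from origin to destination, hence \<open>\<infinity>\<close> if there is none; in particular if the
  origin or the destination is not a node of \<open>S\<close>. As arc lengths are nonnegative, it is
  attained by a shortest path whenever it is finite: see \<open>shortest_length_path\<close> below.
\<close>

definition shortest_length :: "'v nd_instance \<Rightarrow> 'v ugraph \<Rightarrow> 'v \<times> 'v \<Rightarrow> ereal" where
  "shortest_length I S w =
     wf_digraph.\<mu> (with_proj (bidirected S)) (arc_length I) (fst w) (snd w)"

definition travel_length :: "'v nd_instance \<Rightarrow> 'v ugraph \<Rightarrow> 'v \<times> 'v \<Rightarrow> real" where
  "travel_length I S w = real_of_ereal (min (shortest_length I S w) (ereal (utility I w)))"

definition total_demand :: "'v nd_instance \<Rightarrow> real" where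
  "total_demand I = (\<Sum>w\<in>od_pairs I. demand I w)"

definition F_m :: "'v nd_instance \<Rightarrow> 'v ugraph \<Rightarrow> real" where
  "F_m I S = 1 / total_demand I * (\<Sum>w\<in>od_pairs I. demand I w * travel_length I S w)"

definition F_c :: "'v nd_instance \<Rightarrow> 'v ugraph \<Rightarrow> real" where
  "F_c I S = (MAX w\<in>od_pairs I. travel_length I S w)"

definition H :: "'v nd_instance \<Rightarrow> real \<Rightarrow> 'v ugraph \<Rightarrow> real" where
  "H I lam S = lam * F_c I S + (1 - lam) * F_m I S"

definition H_bar :: "'v nd_instance \<Rightarrow> real \<Rightarrow> 'v ugraph \<Rightarrow> real" where
  "H_bar I lam S = max (lam * F_c I S) ((1 - lam) * F_m I S)"

definition maximum_cent_dian :: "'v nd_instance \<Rightarrow> real \<Rightarrow> real \<Rightarrow> 'v ugraph \<Rightarrow> bool" where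
  "maximum_cent_dian I \<alpha> lam S \<longleftrightarrow>
     is_arg_min (H I lam) (is_arg_min (H_bar I lam) (\<lambda>T. T \<in> feasible I \<alpha>)) S"

definition pareto_optimal :: "'v nd_instance \<Rightarrow> real \<Rightarrow> 'v ugraph set" where
  "pareto_optimal I \<alpha> =
     {S \<in> feasible I \<alpha>. \<not> (\<exists>S' \<in> feasible I \<alpha>.
        F_m I S' \<le> F_m I S \<and> F_c I S' \<le> F_c I S \<and> (F_m I S' < F_m I S \<or> F_c I S' < F_c I S))}"

lemma fin_digraph_bidirected:
  assumes "wf_ugraph S"
  shows "fin_digraph (with_proj (bidirected S))"
proof -
  have sub: "{(i, j). {i, j} \<in> edges S} \<subseteq> nodes S \<times> nodes S"
    using assms by (fastforce simp: wf_ugraph_def doubleton_eq_iff)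
  moreover have fin: "finite (nodes S)"
    using assms by (simp add: wf_ugraph_def)
  ultimately have "finite {(i, j). {i, j} \<in> edges S}"
    using finite_subset by blast
  with sub fin show ?thesis
    by unfold_locales (auto simp: bidirected_def)
qed

lemma shortest_length_path:
  fixes S :: "'v ugraph" and w :: "'v \<times> 'v"
  assumes inst: "network_design I" and sub: "usubgraph S (network I)"
  defines "path \<equiv> \<lambda>p. pre_digraph.apath (with_proj (bidirected S)) (fst w) p (snd w)"
    and "len \<equiv> \<lambda>p. sum_list (map (arc_length I) p)"
  shows "(\<nexists>p. path p) \<Longrightarrow> shortest_length I S w = \<infinity>"
    and "path p \<Longrightarrow>
      \<exists>q. path q \<and> shortest_length I S w = ereal (len q) \<and> (\<forall>r. path r \<longrightarrow> len q \<le> len r)"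
proof -
  interpret G: fin_digraph "with_proj (bidirected S)"
    using sub by (intro fin_digraph_bidirected) (simp add: usubgraph_def)
  have nonneg: "0 \<le> arc_length I a" if "a \<in> arcs (with_proj (bidirected S))" for a
    using that sub network_design.arc_length_nonneg[OF inst]
    by (auto simp: bidirected_def usubgraph_def)
  show "shortest_length I S w = \<infinity>" if "\<nexists>p. path p"
  proof -
    have "\<not> fst w \<rightarrow>\<^sup>*\<^bsub>with_proj (bidirected S)\<^esub> snd w"
      using that unfolding path_def by (metis G.apath_awalk_to_apath G.reachable_awalk)
    then show ?thesis
      unfolding shortest_length_def by (rule G.shortest_path_inf)
  qed
  show "\<exists>q. path q \<and> shortest_length I S w = ereal (len q) \<and> (\<forall>r. path r \<longrightarrow> len q \<le> len r)"
    if "path p"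
  proof -
    have "fst w \<rightarrow>\<^sup>*\<^bsub>with_proj (bidirected S)\<^esub> snd w"
      using that unfolding path_def by (auto simp: G.reachable_awalk G.apath_def)
    then obtain q where q: "path q" "shortest_length I S w = ereal (len q)"
      using G.min_cost_awalk[of "fst w" "snd w" "arc_length I"] nonneg
      unfolding path_def len_def shortest_length_def G.awalk_cost_def by blast
    have "len q \<le> len r" if "path r" for r
    proof -
      have "shortest_length I S w \<le> ereal (len r)"
        using that G.min_cost_le_walk_cost[of "fst w" r "snd w" "arc_length I"]
        unfolding path_def len_def shortest_length_def G.awalk_cost_def G.apath_def by blast
      then show ?thesis using q(2) by simp
    qed
    with q show ?thesis by blast
  qed
qed

end

theory Submission
  imports Defs
begin

text \<open>
  A subgraph that Pareto-dominates \<open>S\<close> does at least as well as \<open>S\<close> in \<open>H_bar\<close>, the maximum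
  of the two weighted objectives, but not necessarily better: the objective that improves may be
  the one that does not attain the maximum. The second lexicographic level excludes exactly this.
  If \<open>S\<close> minimizes \<open>H_bar\<close>, a dominating subgraph is another minimizer, so it competes with \<open>S\<close> in
  \<open>H\<close>; and \<open>H\<close> strictly decreases under domination because both weights \<open>lam\<close> and \<open>1 - lam\<close> are
  positive. These two monotonicity facts, \<open>H_bar_mono\<close> and \<open>H_strict_mono\<close>, contradict the
  lexicographic optimality of \<open>S\<close>.
\<close>

lemma H_bar_mono:
  assumes "0 \<le> lam" "lam \<le> 1" and "F_m I S' \<le> F_m I S" "F_c I S' \<le> F_c I S"
  shows "H_bar I lam S' \<le> H_bar I lam S"
  using assms unfolding H_bar_def by (intro max.mono mult_left_mono) auto

lemma H_strict_mono:
  assumes "0 < lam" "lam < 1" and "F_m I S' \<le> F_m I S" "F_c I S' \<le> F_c I S"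
    and "F_m I S' < F_m I S \<or> F_c I S' < F_c I S"
  shows "H I lam S' < H I lam S"
  using assms(5)
proof
  assume "F_m I S' < F_m I S"
  with assms show ?thesis
    unfolding H_def by (intro add_le_less_mono mult_left_mono mult_strict_left_mono) auto
next
  assume "F_c I S' < F_c I S"
  with assms show ?thesis
    unfolding H_def by (intro add_less_le_mono mult_left_mono mult_strict_left_mono) auto
qed

theorem proposition4:
  fixes I :: "'v nd_instance" and \<alpha> lam :: real and S :: "'v ugraph"
  assumes "network_design I"
    and "0 \<le> \<alpha>" and "\<alpha> \<le> 1"
    and "0 < lam" and "lam < 1"
    and "maximum_cent_dian I \<alpha> lam S"
  shows "S \<in> pareto_optimal I \<alpha>"
proof -
  let ?min = "is_arg_min (H_bar I lam) (\<lambda>T. T \<in> feasible I \<alpha>)"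
  have S_min: "?min S" and S_best: "\<And>T. ?min T \<Longrightarrow> \<not> H I lam T < H I lam S"
    using assms(6) unfolding maximum_cent_dian_def is_arg_min_def[of "H I lam"] by auto
  have False
    if S': "S' \<in> feasible I \<alpha>" and le: "F_m I S' \<le> F_m I S" "F_c I S' \<le> F_c I S"
      and strict: "F_m I S' < F_m I S \<or> F_c I S' < F_c I S" for S'
  proof -
    have "H_bar I lam S' \<le> H_bar I lam S"
      using assms(4,5) le by (intro H_bar_mono) auto
    with S_min S' have "?min S'"
      unfolding is_arg_min_def by (meson order_less_le_trans)
    moreover have "H I lam S' < H I lam S"
      using H_strict_mono[OF assms(4,5) le strict] .
    ultimately show False using S_best by blast
  qed
  moreover have "S \<in> feasible I \<alpha>"
    using S_min by (simp add: is_arg_min_def)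
  ultimately show ?thesis
    unfolding pareto_optimal_def by blast
qed

end
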